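(* Let $n\ge 1$ be an integer and $\ell:=\lfloor (n-1)/2\rfloor$. Let $$F(\rho_0,\dots,\rho_\ell,m_0,\dots,m_\ell):=-\sum_{i=0}^{\ell}\rho_i m_i+2\log 2\sum_{i=0}^{\ell}m_i^2+\frac{n+1}{2}\sum_{k=0}^{n}\sum_{j=1}^{n}\psi^{(-2)}\left(\frac{m_{k-j}-m_k+j}{n+1}\right),$$ where in the last term $m_{j+n+1}=m_j$ and $m_j=-m_{n-j}$ for all $j$. Then $F$ is a generating function of the transformation $$(m_0,\dots,m_\ell,\rho_0,\dots,\rho_\ell)\mapsto(m_0,\dots,m_\ell,\log e_0^{\mathbb R},\dots,\log e_\ell^{\mathbb R})$$ with respect to the symplectic forms $-\frac12\sum_{i=0}^{\ell}d\gamma_i\wedge d\rho_i$ (with $\gamma_i=-2m_i$) and $\sum_{i=0}^{\ell}dm_i\wedge d\log e_i^{\mathbb R}$. More precisely, for $0\le i\le \ell$, $$m_i=-\frac{\partial F}{\partial\rho_i},\qquad \log e_i^{\mathbb R}=-\frac{\partial F}{\partial m_i}.$$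
   Context: The function $\psi^{(-2)}$ is $\psi^{(-2)}(z)=\int_0^z\log\Gamma(x)\,dx=\frac{z(1-z)}{2}+\frac z2\log 2\pi+z\log\Gamma(z)-\log G(1+z)$, where $\Gamma$ is the Euler Gamma function and $G$ is the Barnes $G$-function. The tt*-Toda equations are $2(w_i)_{t\bar t}=-e^{2(w_{i+1}-w_i)}+e^{2(w_i-w_{i-1})}$ for $w_i:\mathbb C^*\to\mathbb R$, $i\in\mathbb Z$, with $w_{i+n+1}=w_i$, $w_i=w_i(|t|)$ and $w_i+w_{n-i}=0$. Their generic local solutions near $x=|t|=0$ are parametrized by real asymptotic data $\gamma_i,\rho_i$ through $2w_i(x)=\gamma_i\log x+\rho_i+o(1)$ as $x\to0$. Conventions on the data: $\gamma_{i+n+1}=\gamma_i$ and $\gamma_{n-i}=-\gamma_i$ for all $i$, and likewise for $\rho_i$ (so when $n$ is even $\gamma_{n/2}=\rho_{n/2}=0$). "Generic" means $-2<\gamma_{i+1}-\gamma_i<2$ for all $i\in\mathbb Z$, and this is assumed; the $\rho_i$ ($0\le i\le\ell$) are arbitrary reals. The monodromy data are given in terms of the asymptotic data by the formulas (taken here as their definition) $$m_i=-\tfrac12\gamma_i,\qquad e_i^{\mathbb R}=e^{\rho_i}\,2^{2\gamma_i}\,\frac{X_{n-i}(\gamma_0,\dots,\gamma_n)}{X_i(\gamma_0,\dots,\gamma_n)},$$ where $(\gamma_0,\dots,\gamma_n)$ is the full antisymmetric vector determined by $\gamma_0,\dots,\gamma_\ell$, and $$X_k(\gamma_0,\dots,\gamma_n):=\prod_{j=1}^{n}\Gamma\left(\frac{\gamma_{k+j}-\gamma_k+2j}{2(n+1)}\right),\qquad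 \gamma_{j+n+1}=\gamma_j.$$ Via $\gamma_i=-2m_i$, $e_i^{\mathbb R}$ is regarded as a function of $(m_0,\dots,m_\ell,\rho_0,\dots,\rho_\ell)$; the partial derivatives of $F$ are taken with respect to these independent variables. *)

theory Defs
  imports "HOL-Analysis.Analysis"
begin

definition ell :: "nat \<Rightarrow> nat" where
  "ell n = (n - 1) div 2"

text \<open>The full vector indexed by the integers that is determined by its entries
  \<open>a 0, \<dots>, a (ell n)\<close> through \<open>a (i + n + 1) = a i\<close> and \<open>a (n - i) = - a i\<close>.
  The values of \<open>a\<close> beyond \<open>ell n\<close> are never used.\<close>

definition antisym_ext :: "nat \<Rightarrow> (nat \<Rightarrow> real) \<Rightarrow> int \<Rightarrow> real" where
  "antisym_ext n a i =
     (let r = nat (i mod (int n + 1))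
      in if 2 * r < n then a r else if 2 * r = n then 0 else - a (n - r))"

lemma antisym_ext_base: "n \<ge> 1 \<Longrightarrow> i \<le> ell n \<Longrightarrow> antisym_ext n a (int i) = a i"
  by (auto simp: antisym_ext_def ell_def Let_def nat_mod_as_int [symmetric])

lemma antisym_ext_periodic: "antisym_ext n a (i + int n + 1) = antisym_ext n a i"
proof -
  have "(i + int n + 1) mod (int n + 1) = i mod (int n + 1)"
    by (metis add.assoc mod_add_self2)
  then show ?thesis by (simp add: antisym_ext_def)
qed

lemma antisym_ext_antisym: "antisym_ext n a (int n - i) = - antisym_ext n a i"
proof -
  define r where "r = i mod (int n + 1)"
  have r: "0 \<le> r" "r \<le> int n"
    using pos_mod_bound[of "int n + 1" i] by (auto simp: r_def)
  have "(int n - i) mod (int n + 1) = (int n - r) mod (int n + 1)"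
    unfolding r_def by (simp add: mod_diff_right_eq)
  also have "\<dots> = int n - r" using r by simp
  finally have eq: "(int n - i) mod (int n + 1) = int n - r" .
  have "nat (int n - r) = n - nat r" "nat r \<le> n" using r by auto
  then show ?thesis
    unfolding antisym_ext_def Let_def eq r_def[symmetric]
    by (cases "2 * nat r < n"; cases "2 * nat r = n") auto
qed

definition gamma_data :: "nat \<Rightarrow> (nat \<Rightarrow> real) \<Rightarrow> int \<Rightarrow> real" where
  "gamma_data n m i = - 2 * antisym_ext n m i"

definition generic :: "nat \<Rightarrow> (nat \<Rightarrow> real) \<Rightarrow> bool" where
  "generic n m \<longleftrightarrow>
     (\<forall>i::int. - 2 < gamma_data n m (i + 1) - gamma_data n m i \<and>
               gamma_data n m (i + 1) - gamma_data n m i < 2)"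

definition X_prod :: "nat \<Rightarrow> (int \<Rightarrow> real) \<Rightarrow> int \<Rightarrow> real" where
  "X_prod n g k = (\<Prod>j=1..n. Gamma ((g (k + int j) - g k + 2 * real j) / (2 * (real n + 1))))"

definition eR :: "nat \<Rightarrow> (nat \<Rightarrow> real) \<Rightarrow> (nat \<Rightarrow> real) \<Rightarrow> nat \<Rightarrow> real" where
  "eR n m \<rho> i =
     exp (\<rho> i) * 2 powr (2 * gamma_data n m (int i)) *
     (X_prod n (gamma_data n m) (int n - int i) / X_prod n (gamma_data n m) (int i))"

text \<open>Only evaluated at \<open>z > 0\<close>; the integrand has an integrable (logarithmic)
  singularity at 0, where HOL assigns it the value 0.\<close>

definition psi_neg2 :: "real \<Rightarrow> real" where
  "psi_neg2 z = integral {0..z} (\<lambda>x. ln (Gamma x))"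

definition genF :: "nat \<Rightarrow> (nat \<Rightarrow> real) \<Rightarrow> (nat \<Rightarrow> real) \<Rightarrow> real" where
  "genF n \<rho> m =
     - (\<Sum>i=0..ell n. \<rho> i * m i) + 2 * ln 2 * (\<Sum>i=0..ell n. (m i)\<^sup>2)
     + (real n + 1) / 2 *
       (\<Sum>k=0..n. \<Sum>j=1..n.
          psi_neg2 ((antisym_ext n m (int k - int j) - antisym_ext n m (int k) + real j)
                    / (real n + 1)))"

text \<open>A two-form on an open subset of a vector space assigns to each point \<open>p\<close> an
  antisymmetric bilinear function of two tangent vectors; all two-forms below have constant
  coefficients, so \<open>p\<close> is omitted.  One-forms are functions of the point and a tangent vector.\<close>

definition wedge :: "('a \<Rightarrow> real) \<Rightarrow> ('a \<Rightarrow> real) \<Rightarrow> 'a \<Rightarrow> 'a \<Rightarrow> real" where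
  "wedge \<alpha> \<beta> u v = \<alpha> u * \<beta> v - \<alpha> v * \<beta> u"

definition primitive_of ::
    "('a::real_normed_vector \<Rightarrow> 'a \<Rightarrow> real) \<Rightarrow> ('a \<Rightarrow> 'a \<Rightarrow> real) \<Rightarrow> bool" where
  "primitive_of \<theta> \<omega> \<longleftrightarrow>
     (\<forall>p. \<exists>D. (\<forall>v. ((\<lambda>q. \<theta> q v) has_derivative D v) (at p)) \<and>
              (\<forall>u v. \<omega> u v = D v u - D u v))"

text \<open>\<open>F\<close> is a generating function of the symplectic transformation \<open>\<Phi>\<close> with respect to
  \<open>\<omega>\<^sub>1 = d\<theta>\<^sub>1\<close> and \<open>\<omega>\<^sub>2 = d\<theta>\<^sub>2\<close>: on \<open>U\<close>, the pull-back of \<open>\<omega>\<^sub>2\<close> is \<open>\<omega>\<^sub>1\<close>, and \<open>dF\<close> is the pull-back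
  of \<open>\<theta>\<^sub>2\<close> minus \<open>\<theta>\<^sub>1\<close>.\<close>

definition generating_function_on ::
    "'a::real_normed_vector set \<Rightarrow> ('a \<Rightarrow> 'a \<Rightarrow> real) \<Rightarrow> ('b::real_normed_vector \<Rightarrow> 'b \<Rightarrow> real) \<Rightarrow>
     ('a \<Rightarrow> 'a \<Rightarrow> real) \<Rightarrow> ('b \<Rightarrow> 'b \<Rightarrow> real) \<Rightarrow> ('a \<Rightarrow> 'b) \<Rightarrow> ('a \<Rightarrow> real) \<Rightarrow> bool" where
  "generating_function_on U \<omega>\<^sub>1 \<omega>\<^sub>2 \<theta>\<^sub>1 \<theta>\<^sub>2 \<Phi> F \<longleftrightarrow>
     primitive_of \<theta>\<^sub>1 \<omega>\<^sub>1 \<and> primitive_of \<theta>\<^sub>2 \<omega>\<^sub>2 \<and>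
     (\<forall>p\<in>U. \<exists>D. (\<Phi> has_derivative D) (at p) \<and>
        (\<forall>u v. \<omega>\<^sub>2 (D u) (D v) = \<omega>\<^sub>1 u v) \<and>
        (F has_derivative (\<lambda>u. \<theta>\<^sub>2 (\<Phi> p) (D u) - \<theta>\<^sub>1 p u)) (at p))"

text \<open>The data live in \<open>\<real>\<^bsup>ell n + 1\<^esup> \<times> \<real>\<^bsup>ell n + 1\<^esup>\<close>.  The coordinates of \<open>\<real>\<^bsup>ell n + 1\<^esup>\<close> are
  indexed by a finite type whose elements are numbered \<open>0, \<dots>, ell n\<close> by a bijection \<open>idx\<close>.\<close>

type_synonym 'l phase = "(real ^ 'l) \<times> (real ^ 'l)"

definition coords :: "('l::finite \<Rightarrow> nat) \<Rightarrow> real ^ 'l \<Rightarrow> nat \<Rightarrow> real" where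
  "coords idx v k = v $ inv idx k"

definition generic_set :: "nat \<Rightarrow> ('l::finite \<Rightarrow> nat) \<Rightarrow> 'l phase set" where
  "generic_set n idx = {(m, \<rho>). generic n (coords idx m)}"

definition monodromy_map :: "nat \<Rightarrow> ('l::finite \<Rightarrow> nat) \<Rightarrow> 'l phase \<Rightarrow> 'l phase" where
  "monodromy_map n idx =
     (\<lambda>(m, \<rho>). (m, \<chi> i. ln (eR n (coords idx m) (coords idx \<rho>) (idx i))))"

text \<open>\<open>- 1/2 \<Sum> d\<gamma>\<^sub>i \<and> d\<rho>\<^sub>i\<close> in the coordinates \<open>(m, \<rho>)\<close>, where \<open>d\<gamma>\<^sub>i = - 2 dm\<^sub>i\<close>,
  with primitive \<open>\<Sum> m\<^sub>i d\<rho>\<^sub>i\<close>.\<close>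

definition omega_asym :: "('l::finite) phase \<Rightarrow> 'l phase \<Rightarrow> real" where
  "omega_asym u v =
     - (1 / 2) * (\<Sum>i\<in>UNIV. wedge (\<lambda>u. - 2 * fst u $ i) (\<lambda>u. snd u $ i) u v)"

definition theta_asym :: "('l::finite) phase \<Rightarrow> 'l phase \<Rightarrow> real" where
  "theta_asym p u = (\<Sum>i\<in>UNIV. fst p $ i * snd u $ i)"

text \<open>\<open>\<Sum> dm\<^sub>i \<and> dE\<^sub>i\<close> in the coordinates \<open>(m, E)\<close>, where \<open>E\<^sub>i = log e\<^sub>i\<close>,
  with primitive \<open>- \<Sum> E\<^sub>i dm\<^sub>i\<close>.\<close>

definition omega_mono :: "('l::finite) phase \<Rightarrow> 'l phase \<Rightarrow> real" where
  "omega_mono u v = (\<Sum>i\<in>UNIV. wedge (\<lambda>u. fst u $ i) (\<lambda>u. snd u $ i) u v)"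

definition theta_mono :: "('l::finite) phase \<Rightarrow> 'l phase \<Rightarrow> real" where
  "theta_mono p u = - (\<Sum>i\<in>UNIV. snd p $ i * fst u $ i)"

lemma primitive_asym: "primitive_of (theta_asym :: ('l::finite) phase \<Rightarrow> _) omega_asym"
  unfolding primitive_of_def
proof (intro allI exI conjI)
  fix p v u w :: "'l phase"
  show "((\<lambda>q. theta_asym q v) has_derivative (\<lambda>u. \<Sum>i\<in>UNIV. fst u $ i * snd v $ i)) (at p)"
    unfolding theta_asym_def by (auto intro!: derivative_eq_intros
        bounded_linear.has_derivative[OF bounded_linear_vec_nth])
  show "omega_asym u w = (\<Sum>i\<in>UNIV. fst u $ i * snd w $ i) - (\<Sum>i\<in>UNIV. fst w $ i * snd u $ i)"
    by (simp add: omega_asym_def wedge_def sum_subtractf[symmetric] sum_distrib_left algebra_simps)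
qed

lemma primitive_mono: "primitive_of (theta_mono :: ('l::finite) phase \<Rightarrow> _) omega_mono"
  unfolding primitive_of_def
proof (intro allI exI conjI)
  fix p v u w :: "'l phase"
  show "((\<lambda>q. theta_mono q v) has_derivative (\<lambda>u. - (\<Sum>i\<in>UNIV. snd u $ i * fst v $ i))) (at p)"
    unfolding theta_mono_def by (auto intro!: derivative_eq_intros
        bounded_linear.has_derivative[OF bounded_linear_vec_nth])
  show "omega_mono u w = - (\<Sum>i\<in>UNIV. snd u $ i * fst w $ i) - - (\<Sum>i\<in>UNIV. snd w $ i * fst u $ i)"
    by (simp add: omega_mono_def wedge_def sum_subtractf[symmetric] algebra_simps)
qed

end

theory Submission
  imports Defs "HOL-Real_Asymp.Real_Asymp"
begin

text \<open>
  Write \<open>A\<close> and \<open>U\<close> for the antisymmetric extensions of the point \<open>m\<close> and of a tangent vector \<open>u\<close>, and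
  put \<open>N = n + 1\<close> and \<open>c(k, j) = (A\<^sub>k - A\<^bsub>k+j\<^esub> + j) / N\<close>.  A shift of \<open>k\<close> by \<open>j\<close> turns the arguments of
  \<open>\<psi>\<^sup>(\<^sup>-\<^sup>2\<^sup>)\<close> in \<open>F\<close> into the \<open>c(k, j)\<close>, and the arguments of the Gamma factors of \<open>X\<^sub>k\<close> are the same
  numbers.  On the generic region they are positive, so that the derivative \<open>log \<Gamma>\<close> of
  \<open>\<psi>\<^sup>(\<^sup>-\<^sup>2\<^sup>)\<close> is available there, and the last term of \<open>F\<close> has the derivative
  \<open>1/2 \<Sum>\<^sub>k \<Sum>\<^sub>j log \<Gamma>(c(k, j)) (U\<^sub>k - U\<^bsub>k+j\<^esub>)\<close> in the direction \<open>u\<close>.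

  Everything rests on one symmetry.  The involution \<open>k \<mapsto> n - k - j\<close> exchanges \<open>k\<close> and \<open>k + j\<close> up to
  the reflection \<open>i \<mapsto> n - i\<close>, under which \<open>A\<close> and \<open>U\<close> change sign.  Hence it fixes \<open>c(k, j)\<close> and
  sends \<open>U\<^sub>k\<close> to \<open>- U\<^bsub>k+j\<^esub>\<close>, so for any \<open>f\<close> that is periodic in \<open>k\<close> and invariant
  under the involution
  \<open>\<Sum>\<^sub>k f(k, j) (U\<^sub>k - U\<^bsub>k+j\<^esub>) = 2 \<Sum>\<^sub>k f(k, j) U\<^sub>k\<close> (lemma \<open>symmetrise_antisym_sum\<close>).

  For \<open>f(k, j) = log \<Gamma>(c(k, j))\<close> this gives the derivative \<open>\<Sum>\<^sub>k U\<^sub>k log X\<^sub>k\<close>, which the antisymmetry of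
  \<open>U\<close> folds into \<open>\<Sum>\<^sub>i u\<^sub>i (log X\<^sub>i - log X\<^bsub>n-i\<^esub>)\<close> over \<open>0 \<le> i \<le> \<ell>\<close> (lemma \<open>fold_antisym_sum\<close>).
  Together with the two elementary terms of \<open>F\<close> this is
  \<open>dF = - \<Sum> log e\<^sub>i dm\<^sub>i - \<Sum> m\<^sub>i d\<rho>\<^sub>i\<close>, that is, both partial derivatives and the statement that \<open>dF\<close> is
  the difference of the two primitives.

  That the transformation is symplectic amounts to the symmetry in \<open>u, v\<close> of the derivative of
  \<open>\<Sum>\<^sub>k U\<^sub>k log X\<^sub>k\<close> in the direction \<open>v\<close>.  It follows from the same symmetrisation, now with
  \<open>f(k, j) = \<Gamma>'/\<Gamma>(c(k, j)) (V\<^sub>k - V\<^bsub>k+j\<^esub>) / N\<close> (lemma \<open>dlog_X_symmetric\<close>): the result contains \<open>u\<close>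
  and \<open>v\<close> only through the product \<open>(U\<^sub>k - U\<^bsub>k+j\<^esub>) (V\<^sub>k - V\<^bsub>k+j\<^esub>)\<close>.
\<close>

section \<open>Sums over a period and the reflection symmetry\<close>

lemma sum_shift_periodic:
  fixes f :: "int \<Rightarrow> real"
  assumes per: "\<And>k. f (k + int n + 1) = f k"
  shows "(\<Sum>k=0..n. f (int k + int c)) = (\<Sum>k=0..n. f (int k))"
proof (induction c)
  case (Suc c)
  have "(\<Sum>k=0..n. f (int k + int (Suc c))) = (\<Sum>k=0..n. f (int (Suc k) + int c))"
    by (simp add: algebra_simps)
  also have "\<dots> = (\<Sum>k=0..Suc n. f (int k + int c)) - f (int c)"
    by (subst sum.atLeast0_atMost_Suc_shift) simp
  also have "\<dots> = (\<Sum>k=0..n. f (int k + int c)) + f (int c + int n + 1) - f (int c)"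
    by (simp add: algebra_simps)
  finally show ?case using Suc per by simp
qed simp

lemma sum_reflect_periodic:
  fixes f :: "int \<Rightarrow> real"
  assumes per: "\<And>k. f (k + int n + 1) = f k"
  shows "(\<Sum>k=0..n. f (int n - int k - int j)) = (\<Sum>k=0..n. f (int k))"
proof -
  have "(\<Sum>k=0..n. f (int n - int k - int j)) = (\<Sum>k=0..n. f (int k - int j))"
    by (rule sum.reindex_bij_witness[where i="\<lambda>k. n - k" and j="\<lambda>k. n - k"]) (auto simp: of_nat_diff)
  also have "\<dots> = (\<Sum>k=0..n. f (int k + int j - int j))"
    by (rule sum_shift_periodic[of "\<lambda>k. f (k - int j)", symmetric]) (use per[of "_ - int j"] in \<open>simp add: algebra_simps\<close>)
  finally show ?thesis by simp
qed

text \<open>The numbers \<open>c(k, j)\<close>: the arguments that \<open>F\<close> and the products \<open>X\<^sub>k\<close> have in common.\<close>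
definition gap :: "nat \<Rightarrow> (nat \<Rightarrow> real) \<Rightarrow> int \<Rightarrow> nat \<Rightarrow> real" where
  "gap n a k j = (antisym_ext n a k - antisym_ext n a (k + int j) + real j) / (real n + 1)"

lemma gap_periodic: "gap n a (k + int n + 1) j = gap n a k j"
  using antisym_ext_periodic[of n a k] antisym_ext_periodic[of n a "k + int j"]
  by (simp add: gap_def algebra_simps)

lemma antisym_ext_reflect: "antisym_ext n a (int n - k - int j) = - antisym_ext n a (k + int j)"
  using antisym_ext_antisym[of n a "k + int j"] by (simp add: algebra_simps)

lemma antisym_ext_diff_reflect:
  "antisym_ext n a (int n - k - int j) - antisym_ext n a (int n - k - int j + int j)
   = antisym_ext n a k - antisym_ext n a (k + int j)"
  by (simp add: antisym_ext_reflect antisym_ext_antisym)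

lemma gap_reflect: "gap n a (int n - k - int j) j = gap n a k j"
  unfolding gap_def antisym_ext_diff_reflect ..

text \<open>The substitution \<open>k \<mapsto> n - k - j\<close> permutes the residues modulo \<open>n + 1\<close>.  It preserves \<open>f\<close> and turns
  \<open>U\<^sub>k\<close> into \<open>- U\<^bsub>k+j\<^esub>\<close>, so the two halves of the difference contribute equally.\<close>
lemma symmetrise_antisym_sum:
  fixes f :: "int \<Rightarrow> nat \<Rightarrow> real"
  assumes per: "\<And>k j. f (k + int n + 1) j = f k j"
    and refl: "\<And>k j. f (int n - k - int j) j = f k j"
  shows "(\<Sum>k=0..n. \<Sum>j=1..n. f (int k) j * (antisym_ext n u (int k) - antisym_ext n u (int k + int j)))
       = 2 * (\<Sum>k=0..n. antisym_ext n u (int k) * (\<Sum>j=1..n. f (int k) j))"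
proof -
  let ?U = "antisym_ext n u"
  have flip: "(\<Sum>k=0..n. f (int k) j * ?U (int k + int j)) = - (\<Sum>k=0..n. f (int k) j * ?U (int k))" for j
  proof -
    have "(\<Sum>k=0..n. f (int k) j * ?U (int k))
        = (\<Sum>k=0..n. f (int n - int k - int j) j * ?U (int n - int k - int j))"
      by (rule sum_reflect_periodic[symmetric]) (simp add: per antisym_ext_periodic)
    then show ?thesis by (simp add: refl antisym_ext_reflect sum_negf)
  qed
  have "(\<Sum>k=0..n. \<Sum>j=1..n. f (int k) j * (?U (int k) - ?U (int k + int j)))
      = (\<Sum>j=1..n. \<Sum>k=0..n. f (int k) j * (?U (int k) - ?U (int k + int j)))"
    by (rule sum.swap)
  also have "\<dots> = (\<Sum>j=1..n. 2 * (\<Sum>k=0..n. f (int k) j * ?U (int k)))"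
    by (simp add: right_diff_distrib sum_subtractf flip)
  also have "\<dots> = 2 * (\<Sum>k=0..n. \<Sum>j=1..n. f (int k) j * ?U (int k))"
    by (subst sum.swap) (simp add: sum_distrib_left)
  finally show ?thesis by (simp add: sum_distrib_left mult_ac)
qed

lemma ell_less: "n \<ge> 1 \<Longrightarrow> i \<le> ell n \<longleftrightarrow> 2 * i < n"
  by (auto simp: ell_def)

text \<open>The index \<open>k = n / 2\<close>, present for even \<open>n\<close>, contributes nothing, and the indices above it are the
  reflections \<open>n - i\<close> of those below, with \<open>U\<^bsub>n-i\<^esub> = - u\<^sub>i\<close>.\<close>
lemma fold_antisym_sum:
  fixes g :: "int \<Rightarrow> real"
  assumes "n \<ge> 1"
  shows "(\<Sum>k=0..n. antisym_ext n u (int k) * g (int k))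
       = (\<Sum>i=0..ell n. u i * (g (int i) - g (int n - int i)))"
proof -
  let ?h = "\<lambda>k. antisym_ext n u (int k) * g (int k)"
  let ?M = "{k. 2 * k = n}" and ?R = "{k. n < 2 * k \<and> k \<le> n}"
  have fin: "finite ?M" "finite ?R"
    by (auto intro: finite_subset[of _ "{0..n}"])
  have split: "{0..n} = {0..ell n} \<union> (?M \<union> ?R)"
  proof (rule set_eqI)
    fix k
    show "k \<in> {0..n} \<longleftrightarrow> k \<in> {0..ell n} \<union> (?M \<union> ?R)"
      using ell_less[OF assms, of k] by auto
  qed
  have low: "?h i = u i * g (int i)" if "i \<le> ell n" for i
    using that assms by (simp add: antisym_ext_base)
  have mid: "antisym_ext n u (int k) = 0" if "2 * k = n" for k
    using antisym_ext_antisym[of n u "int k"] that by auto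
  have "sum ?h {0..n} = sum ?h {0..ell n} + (sum ?h ?M + sum ?h ?R)"
  proof -
    have "?M \<inter> ?R = {}" "{0..ell n} \<inter> (?M \<union> ?R) = {}"
      using ell_less[OF assms] by fastforce+
    then show ?thesis
      unfolding split using fin by (simp only: sum.union_disjoint finite_UnI finite_atLeastAtMost)
  qed
  also have "sum ?h ?M = 0"
    by (rule sum.neutral, intro ballI, drule CollectD) (simp only: mid mult_zero_left)
  also have "sum ?h ?R = (\<Sum>i=0..ell n. - u i * g (int n - int i))"
  proof (rule sum.reindex_bij_witness[where i="\<lambda>k. n - k" and j="\<lambda>k. n - k"], goal_cases)
    case (5 k)
    then have k: "n - k \<le> ell n" "int n - int (n - k) = int k" by (auto simp: ell_def)
    have "antisym_ext n u (int k) = - u (n - k)"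
      using antisym_ext_antisym[of n u "int (n - k)"]
      unfolding k(2) antisym_ext_base[OF assms k(1)] .
    then show ?case by (simp only: k(2))
  qed (insert assms, auto simp: ell_def)
  finally show ?thesis by (simp add: low right_diff_distrib sum_subtractf sum_negf)
qed

text \<open>Genericity bounds one step of \<open>A\<^sub>k - A\<^bsub>k+1\<^esub>\<close> below by \<open>-1\<close>; \<open>j\<close> steps therefore lose strictly less
  than the summand \<open>j\<close> provides.\<close>
lemma gap_pos:
  assumes "generic n m" "j \<ge> 1"
  shows "gap n m k j > 0"
proof -
  have unit_step: "antisym_ext n m k - antisym_ext n m (k + 1) > - 1" for k
  proof -
    have "- 2 < gamma_data n m (k + 1) - gamma_data n m k"
      using assms(1)[unfolded generic_def, THEN spec, of k] by (rule conjunct1)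
    then show ?thesis by (simp add: gamma_data_def)
  qed
  have "antisym_ext n m k - antisym_ext n m (k + int j) + real j > 0"
    using assms(2)
  proof (induction j rule: dec_induct)
    case base
    then show ?case using unit_step[of k] by simp
  next
    case (step j)
    then show ?case using unit_step[of "k + int j"] by (simp add: algebra_simps)
  qed
  then show ?thesis by (simp add: gap_def)
qed

section \<open>The derivative of \<open>\<psi>\<^sup>(\<^sup>-\<^sup>2\<^sup>)\<close>\<close>

text \<open>The antiderivative \<open>x log x - x\<close> is continuous up to the singular endpoint, so the fundamental
  theorem applies with differentiability in the interior only.\<close>
lemma has_integral_ln_from_0:
  fixes z :: real
  assumes "z \<ge> 0"
  shows "(ln has_integral (z * ln z - z)) {0..z}"
proof -
  have cont: "continuous_on {0..z} (\<lambda>x::real. x * ln x - x)"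
  proof (intro continuous_on_diff continuous_on_id)
    show "continuous_on {0..z} (\<lambda>x::real. x * ln x)"
      unfolding continuous_on_def
    proof
      fix x :: real assume "x \<in> {0..z}"
      show "((\<lambda>x. x * ln x) \<longlongrightarrow> x * ln x) (at x within {0..z})"
      proof (cases "x = 0")
        case True
        have "((\<lambda>x::real. x * ln x) \<longlongrightarrow> 0) (at_right 0)"
          by real_asymp
        then show ?thesis
          using True tendsto_within_subset[of _ _ 0 "{0..}" "{0..z}"]
          by (auto simp: at_within_Ici_at_right)
      next
        case False
        then show ?thesis by (intro tendsto_intros) auto
      qed
    qed
  qed
  have "(ln has_integral ((z * ln z - z) - (0 * ln 0 - 0))) {0..z}"
  proof (rule fundamental_theorem_of_calculus_interior[OF assms cont])
    fix x :: real assume "x \<in> {0<..<z}"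
    then show "((\<lambda>x. x * ln x - x) has_vector_derivative ln x) (at x)"
      unfolding has_real_derivative_iff_has_vector_derivative[symmetric]
      by (auto intro!: derivative_eq_intros)
  qed
  then show ?thesis by simp
qed

lemma ln_Gamma_has_real_derivative:
  fixes x :: real
  assumes "x > 0"
  shows "((\<lambda>x. ln (Gamma x)) has_real_derivative Digamma x) (at x)"
proof -
  have "Gamma x > 0" using assms by (rule Gamma_real_pos)
  moreover have "x \<notin> \<int>\<^sub>\<le>\<^sub>0" using assms by (auto elim!: nonpos_Ints_cases)
  ultimately show ?thesis
    by (auto intro!: derivative_eq_intros)
qed

text \<open>Since \<open>\<Gamma>(x) = \<Gamma>(x + 1) / x\<close>, the singularity of \<open>log \<Gamma>\<close> at \<open>0\<close> is that of \<open>- log\<close>.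
  The integrability on \<open>[0, z]\<close> is what makes \<open>\<psi>\<^sup>(\<^sup>-\<^sup>2\<^sup>)\<close> a genuine integral rather than a default value.\<close>
lemma ln_Gamma_integrable_from_0:
  fixes z :: real
  shows "(\<lambda>x. ln (Gamma x)) integrable_on {0..z}"
proof (cases "z \<ge> 0")
  case True
  have "(\<lambda>x::real. ln (Gamma (x + 1))) integrable_on {0..z}"
    by (intro integrable_continuous_real continuous_at_imp_continuous_on ballI
        isCont_o2[OF _ DERIV_isCont[OF ln_Gamma_has_real_derivative]])
      (auto intro!: continuous_intros)
  moreover have "ln integrable_on {0..z}"
    using has_integral_ln_from_0[OF True] by blast
  ultimately have "(\<lambda>x. ln (Gamma (x + 1)) - ln x) integrable_on {0..z}"
    by (rule integrable_diff)
  then show ?thesis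
  proof (rule integrable_spike[where S="{0}"])
    fix x assume "x \<in> {0..z} - {0}"
    then have "x > 0" by auto
    then have "x \<notin> \<int>\<^sub>\<le>\<^sub>0" "Gamma x \<noteq> 0" by (auto elim!: nonpos_Ints_cases simp: less_imp_neq[symmetric])
    then show "ln (Gamma x) = ln (Gamma (x + 1)) - ln x"
      using \<open>x > 0\<close> by (simp add: Gamma_plus1 ln_mult)
  qed simp
qed (simp add: integrable_on_empty)

lemma psi_neg2_has_real_derivative:
  assumes "z > 0"
  shows "(psi_neg2 has_real_derivative ln (Gamma z)) (at z)"
proof -
  have cont: "isCont (\<lambda>x. ln (Gamma x)) z"
    by (rule DERIV_isCont[OF ln_Gamma_has_real_derivative[OF assms]])
  have "((\<lambda>u. integral {0..u} (\<lambda>x. ln (Gamma x))) has_vector_derivative ln (Gamma z))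
          (at z within {0..z + 1})"
    using integral_has_vector_derivative_continuous_at[OF ln_Gamma_integrable_from_0[of "z + 1"],
        of z "{}"] assms cont
    by (auto intro: continuous_at_imp_continuous_at_within)
  moreover have "at z within {0..z + 1} = at z"
    using assms by (auto intro!: at_within_interior)
  ultimately show ?thesis
    by (simp add: has_real_derivative_iff_has_vector_derivative psi_neg2_def[abs_def])
qed

section \<open>Derivatives of the monodromy data and of the generating function\<close>

text \<open>From here on the data are functions \<open>m q\<close>, \<open>\<rho> q\<close> of a point \<open>q\<close> of an arbitrary normed space, with
  derivatives \<open>dm\<close>, \<open>d\<rho>\<close> at \<open>p\<close>.  This covers at once the phase space, where \<open>q\<close> is the pair of data,
  and the partial derivatives, where \<open>q\<close> is a single real coordinate.

  The antisymmetric extension is linear, so it commutes with differentiation.\<close>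
lemma antisym_ext_has_derivative:
  assumes "n \<ge> 1" and "\<And>i. i \<le> ell n \<Longrightarrow> ((\<lambda>q. m q i) has_derivative (\<lambda>v. dm v i)) (at p)"
  shows "((\<lambda>q. antisym_ext n (m q) k) has_derivative (\<lambda>v. antisym_ext n (dm v) k)) (at p)"
proof -
  define r where "r = nat (k mod (int n + 1))"
  have "r \<le> n" using pos_mod_bound[of "int n + 1" k] by (auto simp: r_def)
  then show ?thesis
    using assms(2) ell_less[OF assms(1)]
    unfolding antisym_ext_def Let_def r_def[symmetric]
    by (cases "2 * r < n"; cases "2 * r = n") (auto intro!: has_derivative_minus)
qed

lemma gap_has_derivative:
  assumes "n \<ge> 1" and "\<And>i. i \<le> ell n \<Longrightarrow> ((\<lambda>q. m q i) has_derivative (\<lambda>v. dm v i)) (at p)"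
  shows "((\<lambda>q. gap n (m q) k j) has_derivative
     (\<lambda>v. (antisym_ext n (dm v) k - antisym_ext n (dm v) (k + int j)) / (real n + 1))) (at p)"
  unfolding gap_def
  by (auto intro!: derivative_eq_intros antisym_ext_has_derivative[OF assms] )

text \<open>The factor \<open>2\<close> in the denominator of the arguments of \<open>X\<^sub>k\<close> absorbs \<open>\<gamma> = - 2 m\<close>.\<close>
lemma X_prod_gap: "X_prod n (gamma_data n m) k = (\<Prod>j=1..n. Gamma (gap n m k j))"
  unfolding X_prod_def
proof (rule prod.cong[OF refl], rule arg_cong[where f=Gamma])
  fix j
  have "- 2 * antisym_ext n m (k + int j) - - 2 * antisym_ext n m k + 2 * real j
     = 2 * (antisym_ext n m k - antisym_ext n m (k + int j) + real j)" by simp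
  then show "(gamma_data n m (k + int j) - gamma_data n m k + 2 * real j) / (2 * (real n + 1)) = gap n m k j"
    unfolding gap_def gamma_data_def by (metis mult_divide_mult_cancel_left_if zero_neq_numeral)
qed

definition log_X :: "nat \<Rightarrow> (nat \<Rightarrow> real) \<Rightarrow> int \<Rightarrow> real" where
  "log_X n m k = (\<Sum>j=1..n. ln (Gamma (gap n m k j)))"

text \<open>The derivative of \<open>log_X n m k\<close> with respect to \<open>m\<close> in the direction \<open>u\<close>.\<close>
definition dlog_X :: "nat \<Rightarrow> (nat \<Rightarrow> real) \<Rightarrow> (nat \<Rightarrow> real) \<Rightarrow> int \<Rightarrow> real" where
  "dlog_X n m u k = (\<Sum>j=1..n. Digamma (gap n m k j) *
     ((antisym_ext n u k - antisym_ext n u (k + int j)) / (real n + 1)))"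

text \<open>The hypothesis asks for positivity of only those arguments that occur in \<open>e\<^sub>i\<close>: these are finitely
  many, so the formula persists in a neighbourhood of each generic point.\<close>
lemma ln_eR:
  assumes "n \<ge> 1" "i \<le> ell n" and pos: "\<And>k j. j \<in> {1..n} \<Longrightarrow> k \<in> {int i, int n - int i} \<Longrightarrow> gap n m k j > 0"
  shows "ln (eR n m \<rho> i) = \<rho> i - 4 * ln 2 * m i + log_X n m (int n - int i) - log_X n m (int i)"
proof -
  have X: "X_prod n (gamma_data n m) k > 0" "ln (X_prod n (gamma_data n m) k) = log_X n m k"
    if "k \<in> {int i, int n - int i}" for k
  proof -
    have G: "Gamma (gap n m k j) > 0" if "j \<in> {1..n}" for j
      using pos[OF that] \<open>k \<in> _\<close> by (auto intro: Gamma_real_pos)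
    show "X_prod n (gamma_data n m) k > 0"
      unfolding X_prod_gap by (rule prod_pos) (use G in auto)
    show "ln (X_prod n (gamma_data n m) k) = log_X n m k"
      unfolding X_prod_gap log_X_def by (rule ln_prod) (use G in \<open>auto simp: less_imp_neq[symmetric]\<close>)
  qed
  show ?thesis
    using X[of "int i"] X[of "int n - int i"] antisym_ext_base[OF assms(1,2), of m]
    by (simp add: eR_def ln_mult ln_div ln_powr gamma_data_def)
qed

lemma ln_Gamma_comp_has_derivative:
  fixes g :: "'a::real_normed_vector \<Rightarrow> real"
  assumes "(g has_derivative g') (at p)" "g p > 0"
  shows "((\<lambda>q. ln (Gamma (g q))) has_derivative (\<lambda>v. Digamma (g p) * g' v)) (at p)"
  using has_derivative_compose[OF assms(1)
      ln_Gamma_has_real_derivative[OF assms(2), unfolded has_field_derivative_def]] .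

lemma log_X_has_derivative:
  assumes "n \<ge> 1" and "\<And>i. i \<le> ell n \<Longrightarrow> ((\<lambda>q. m q i) has_derivative (\<lambda>v. dm v i)) (at p)"
    and "generic n (m p)"
  shows "((\<lambda>q. log_X n (m q) k) has_derivative (\<lambda>v. dlog_X n (m p) (dm v) k)) (at p)"
  unfolding log_X_def dlog_X_def
  by (intro has_derivative_sum ln_Gamma_comp_has_derivative gap_has_derivative[OF assms(1,2)]
      gap_pos[OF assms(3)]) auto

lemma ln_eR_has_derivative:
  assumes "n \<ge> 1" and dm: "\<And>i. i \<le> ell n \<Longrightarrow> ((\<lambda>q. m q i) has_derivative (\<lambda>v. dm v i)) (at p)"
    and d\<rho>: "\<And>i. i \<le> ell n \<Longrightarrow> ((\<lambda>q. \<rho> q i) has_derivative (\<lambda>v. d\<rho> v i)) (at p)"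
    and gen: "generic n (m p)" and i: "i \<le> ell n"
  shows "((\<lambda>q. ln (eR n (m q) (\<rho> q) i)) has_derivative
    (\<lambda>v. d\<rho> v i - 4 * ln 2 * dm v i + dlog_X n (m p) (dm v) (int n - int i)
         - dlog_X n (m p) (dm v) (int i))) (at p)"
proof -
  \<comment> \<open>The closed form of \<open>log e\<^sub>i\<close> can be differentiated because it holds near \<open>p\<close>, not only at \<open>p\<close>.\<close>
  have "\<forall>\<^sub>F q in at p. gap n (m q) k j > 0" if "j \<ge> 1" for k j
  proof -
    have "isCont (\<lambda>q. gap n (m q) k j) p"
      by (rule has_derivative_continuous[OF gap_has_derivative[OF assms(1) dm]])
    then show ?thesis
      using order_tendstoD(1) gap_pos[OF gen that] unfolding isCont_def by blast
  qed
  then have "\<forall>\<^sub>F q in at p. \<forall>k\<in>{int i, int n - int i}. \<forall>j\<in>{1..n}. gap n (m q) k j > 0"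
    by (intro eventually_ball_finite ballI) auto
  then have ev: "\<forall>\<^sub>F q in at p. \<rho> q i - 4 * ln 2 * m q i + log_X n (m q) (int n - int i) - log_X n (m q) (int i)
       = ln (eR n (m q) (\<rho> q) i)"
    by eventually_elim (rule ln_eR[OF assms(1) i, symmetric], blast)
  have "((\<lambda>q. \<rho> q i - 4 * ln 2 * m q i + log_X n (m q) (int n - int i) - log_X n (m q) (int i)) has_derivative
    (\<lambda>v. d\<rho> v i - 4 * ln 2 * dm v i + dlog_X n (m p) (dm v) (int n - int i)
         - dlog_X n (m p) (dm v) (int i))) (at p)"
    by (intro has_derivative_add has_derivative_diff has_derivative_mult_right d\<rho> dm i
        log_X_has_derivative[OF assms(1) dm gen])
  then show ?thesis
    by (rule has_derivative_transform_eventually[OF _ ev])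
      (auto intro!: ln_eR[OF assms(1) i, symmetric] gap_pos gen)
qed

text \<open>For each \<open>j\<close> the sum over the period may be shifted by \<open>j\<close>; this brings the arguments \<open>m\<^bsub>k-j\<^esub> - m\<^sub>k + j\<close>
  into the form in which they occur in \<open>X\<^sub>k\<close>.\<close>
lemma genF_gap:
  "genF n \<rho> m = - (\<Sum>i=0..ell n. \<rho> i * m i) + 2 * ln 2 * (\<Sum>i=0..ell n. (m i)\<^sup>2)
     + (real n + 1) / 2 * (\<Sum>k=0..n. \<Sum>j=1..n. psi_neg2 (gap n m (int k) j))"
proof -
  have "(\<Sum>k=0..n. psi_neg2 (gap n m (int k - int j) j)) = (\<Sum>k=0..n. psi_neg2 (gap n m (int k) j))" for j
    using sum_shift_periodic[of "\<lambda>k. psi_neg2 (gap n m (k - int j) j)" n j]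
      gap_periodic[of n m "_ - int j" j]
    by (simp add: algebra_simps)
  then have "(\<Sum>k=0..n. \<Sum>j=1..n. psi_neg2 (gap n m (int k - int j) j))
           = (\<Sum>k=0..n. \<Sum>j=1..n. psi_neg2 (gap n m (int k) j))"
    by (subst (1 2) sum.swap) simp
  then show ?thesis by (simp add: genF_def gap_def)
qed

text \<open>As \<open>c(k, j)\<close> has the derivative \<open>(U\<^sub>k - U\<^bsub>k+j\<^esub>) / N\<close>, the double sum contributes to the gradient
  a sum of the form that \<open>symmetrise_antisym_sum\<close> treats; symmetrising and folding it produces the logarithms of \<open>X\<^sub>i\<close> and \<open>X\<^bsub>n-i\<^esub>\<close>.\<close>
lemma genF_has_derivative:
  assumes "n \<ge> 1" and dm: "\<And>i. i \<le> ell n \<Longrightarrow> ((\<lambda>q. m q i) has_derivative (\<lambda>v. dm v i)) (at p)"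
    and d\<rho>: "\<And>i. i \<le> ell n \<Longrightarrow> ((\<lambda>q. \<rho> q i) has_derivative (\<lambda>v. d\<rho> v i)) (at p)"
    and gen: "generic n (m p)"
  shows "((\<lambda>q. genF n (\<rho> q) (m q)) has_derivative
    (\<lambda>v. - (\<Sum>i=0..ell n. ln (eR n (m p) (\<rho> p) i) * dm v i) - (\<Sum>i=0..ell n. m p i * d\<rho> v i))) (at p)"
proof -
  let ?N = "real n + 1"
  let ?S = "\<lambda>v. \<Sum>k=0..n. \<Sum>j=1..n. ln (Gamma (gap n (m p) (int k) j)) *
      ((antisym_ext n (dm v) (int k) - antisym_ext n (dm v) (int k + int j)) / ?N)"
  have psi: "((\<lambda>q. psi_neg2 (gap n (m q) k j)) has_derivative (\<lambda>v. ln (Gamma (gap n (m p) k j)) *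
      ((antisym_ext n (dm v) k - antisym_ext n (dm v) (k + int j)) / ?N))) (at p)"
    if "j \<ge> 1" for k j
    using has_derivative_compose[OF gap_has_derivative[OF assms(1) dm]
        psi_neg2_has_real_derivative[OF gap_pos[OF gen that], unfolded has_field_derivative_def]] .
  \<comment> \<open>The prefactor \<open>N / 2\<close> of the double sum cancels the \<open>1 / N\<close> from the chain rule and the factor \<open>2\<close>
      from the symmetrisation.\<close>
  have S: "?N / 2 * ?S v = (\<Sum>i=0..ell n. dm v i * (log_X n (m p) (int i) - log_X n (m p) (int n - int i)))" for v
  proof -
    have "?N / 2 * ?S v = 1 / 2 * (\<Sum>k=0..n. \<Sum>j=1..n. ln (Gamma (gap n (m p) (int k) j)) *
      (antisym_ext n (dm v) (int k) - antisym_ext n (dm v) (int k + int j)))"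
      by (simp add: sum_divide_distrib[symmetric]) (simp add: field_simps)
    also have "\<dots> = (\<Sum>k=0..n. antisym_ext n (dm v) (int k) * log_X n (m p) (int k))"
      by (subst symmetrise_antisym_sum) (simp_all add: gap_periodic gap_reflect log_X_def)
    finally show ?thesis by (simp add: fold_antisym_sum[OF assms(1)])
  qed
  have "((\<lambda>q. genF n (\<rho> q) (m q)) has_derivative
    (\<lambda>v. - (\<Sum>i=0..ell n. \<rho> p i * dm v i + d\<rho> v i * m p i)
       + 2 * ln 2 * (\<Sum>i=0..ell n. 2 * m p i * dm v i) + ?N / 2 * ?S v)) (at p)"
    unfolding genF_gap
  proof (intro has_derivative_add has_derivative_minus has_derivative_mult_right has_derivative_sum)
    fix i assume "i \<in> {0..ell n}"
    then have i: "i \<le> ell n" by simp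
    show "((\<lambda>q. \<rho> q i * m q i) has_derivative (\<lambda>v. \<rho> p i * dm v i + d\<rho> v i * m p i)) (at p)"
      by (rule has_derivative_mult[OF d\<rho>[OF i] dm[OF i]])
    show "((\<lambda>q. (m q i)\<^sup>2) has_derivative (\<lambda>v. 2 * m p i * dm v i)) (at p)"
      using has_derivative_power[OF dm[OF i], of 2] by (simp add: mult_ac)
  qed (rule psi, simp)
  moreover have "- (\<Sum>i=0..ell n. \<rho> p i * dm v i + d\<rho> v i * m p i)
       + 2 * ln 2 * (\<Sum>i=0..ell n. 2 * m p i * dm v i) + ?N / 2 * ?S v
     = - (\<Sum>i=0..ell n. ln (eR n (m p) (\<rho> p) i) * dm v i) - (\<Sum>i=0..ell n. m p i * d\<rho> v i)" for v
  proof -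
    have "ln (eR n (m p) (\<rho> p) i) = \<rho> p i - 4 * ln 2 * m p i + log_X n (m p) (int n - int i) - log_X n (m p) (int i)"
      if "i \<in> {0..ell n}" for i
      using that by (intro ln_eR assms(1)) (auto intro!: gap_pos gen)
    then have "(\<Sum>i=0..ell n. ln (eR n (m p) (\<rho> p) i) * dm v i)
       = (\<Sum>i=0..ell n. (\<rho> p i - 4 * ln 2 * m p i + log_X n (m p) (int n - int i) - log_X n (m p) (int i)) * dm v i)"
      by (intro sum.cong) auto
    then show ?thesis
      unfolding S by (simp add: sum_distrib_left sum_subtractf[symmetric] sum.distrib[symmetric]
          sum_negf[symmetric] algebra_simps)
  qed
  ultimately show ?thesis by simp
qed

text \<open>The symmetry of the Hessian of the last term of \<open>F\<close>.  The weight
  \<open>\<Gamma>'/\<Gamma>(c(k, j)) (V\<^sub>k - V\<^bsub>k+j\<^esub>)\<close> is again invariant under \<open>k \<mapsto> n - k - j\<close>, and symmetrising makes \<open>u\<close>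
  enter in the same way as \<open>v\<close>.\<close>
lemma dlog_X_symmetric:
  "(\<Sum>k=0..n. antisym_ext n u (int k) * dlog_X n m v (int k))
 = (\<Sum>k=0..n. antisym_ext n v (int k) * dlog_X n m u (int k))"
proof -
  have per: "antisym_ext n v (k + int n + 1) - antisym_ext n v (k + int n + 1 + int j)
      = antisym_ext n v k - antisym_ext n v (k + int j)" for v k j
    using antisym_ext_periodic[of n v k] antisym_ext_periodic[of n v "k + int j"]
    by (simp add: algebra_simps)
  have sym: "(\<Sum>k=0..n. \<Sum>j=1..n. Digamma (gap n m (int k) j) *
       ((antisym_ext n v (int k) - antisym_ext n v (int k + int j)) / (real n + 1)) *
       (antisym_ext n u (int k) - antisym_ext n u (int k + int j)))
     = 2 * (\<Sum>k=0..n. antisym_ext n u (int k) * dlog_X n m v (int k))" for u v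
    unfolding dlog_X_def
    by (rule symmetrise_antisym_sum) (simp_all only: gap_periodic gap_reflect per antisym_ext_diff_reflect)
  show ?thesis
    using sym[of u v] sym[of v u] by (simp add: mult_ac)
qed

section \<open>The generating function property\<close>

theorem theorem7:
  fixes n :: nat and idx :: "'l::finite \<Rightarrow> nat"
  assumes "n \<ge> 1"
    and "bij_betw idx UNIV {0..ell n}"
  shows "generating_function_on (generic_set n idx)
           omega_asym omega_mono theta_asym theta_mono
           (monodromy_map n idx)
           (\<lambda>(m, \<rho>). genF n (coords idx \<rho>) (coords idx m)) \<and>
         (\<forall>m \<rho> :: nat \<Rightarrow> real. generic n m \<longrightarrow> (\<forall>i \<le> ell n.
            ((\<lambda>s. genF n (\<rho>(i := s)) m) has_real_derivative - m i) (at (\<rho> i)) \<and>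
            ((\<lambda>s. genF n \<rho> (m(i := s))) has_real_derivative - ln (eR n m \<rho> i)) (at (m i))))"
proof (intro conjI allI impI)
  fix m \<rho> :: "nat \<Rightarrow> real" and i
  assume gen: "generic n m" and i: "i \<le> ell n"
  have times_minus: "(*) (- c) = (\<lambda>v. - (v * c))" for c :: real
    by (simp add: fun_eq_iff)
  have upd: "((\<lambda>s. (f(i := s)) k) has_derivative (\<lambda>v. if k = i then v else 0)) (at x)"
    for f :: "nat \<Rightarrow> real" and k x
    by (cases "k = i") auto
  show "((\<lambda>s. genF n (\<rho>(i := s)) m) has_real_derivative - m i) (at (\<rho> i))"
    using genF_has_derivative[OF assms(1), of "\<lambda>_. m" "\<lambda>_ _. 0" "\<rho> i" "\<lambda>s. \<rho>(i := s)"
        "\<lambda>v k. if k = i then v else 0"] upd gen i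
    by (simp add: has_field_derivative_def times_minus if_distrib sum.delta mult_ac cong: if_cong)
  show "((\<lambda>s. genF n \<rho> (m(i := s))) has_real_derivative - ln (eR n m \<rho> i)) (at (m i))"
    using genF_has_derivative[OF assms(1), of "\<lambda>s. m(i := s)" "\<lambda>v k. if k = i then v else 0"
        "m i" "\<lambda>_. \<rho>" "\<lambda>_ _. 0"] upd gen i
    by (simp add: has_field_derivative_def times_minus if_distrib sum.delta mult_ac cong: if_cong)
next
  have coords_idx: "coords idx v (idx l) = v $ l" for v l
    using assms(2) by (simp add: coords_def bij_betw_def)
  have idx_sum: "(\<Sum>i=0..ell n. f i) = (\<Sum>l\<in>UNIV. f (idx l))" for f :: "nat \<Rightarrow> real"
    by (rule sum.reindex_bij_betw[OF assms(2), symmetric])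
  have idx_le: "idx l \<le> ell n" for l
    using assms(2) by (auto simp: bij_betw_def)
  show "generating_function_on (generic_set n idx)
           omega_asym omega_mono theta_asym theta_mono
           (monodromy_map n idx)
           (\<lambda>(m, \<rho>). genF n (coords idx \<rho>) (coords idx m))"
    unfolding generating_function_on_def
  proof (intro conjI ballI primitive_asym primitive_mono)
    fix p :: "'l phase" assume "p \<in> generic_set n idx"
    then have gen: "generic n (coords idx (fst p))"
      by (auto simp: generic_set_def)
    have dm: "((\<lambda>q::'l phase. coords idx (fst q) k) has_derivative (\<lambda>v. coords idx (fst v) k)) (at p)" for k
      unfolding coords_def by (auto intro!: derivative_eq_intros
        bounded_linear.has_derivative[OF bounded_linear_vec_nth])
    have d\<rho>: "((\<lambda>q::'l phase. coords idx (snd q) k) has_derivative (\<lambda>v. coords idx (snd v) k)) (at p)" for k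
      unfolding coords_def by (auto intro!: derivative_eq_intros
        bounded_linear.has_derivative[OF bounded_linear_vec_nth])
    let ?m = "coords idx (fst p)"
    let ?X = "\<lambda>v. dlog_X n ?m (coords idx (fst v))"
    define dE where "dE = (\<lambda>v l. snd v $ l - 4 * ln 2 * fst v $ l
        + ?X v (int n - int (idx l)) - ?X v (int (idx l)))"
    define D where "D = (\<lambda>v. (fst v, \<chi> l. dE v l))"
    have "((\<lambda>q. ln (eR n (coords idx (fst q)) (coords idx (snd q)) (idx l))) has_derivative
        (\<lambda>v. dE v l)) (at p)" for l
      using ln_eR_has_derivative[where \<rho>="\<lambda>q. coords idx (snd q)" and d\<rho>="\<lambda>v. coords idx (snd v)",
          OF assms(1) dm d\<rho> gen idx_le[of l]]
      by (simp add: dE_def coords_idx)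
    then have "((\<lambda>q. \<chi> l. ln (eR n (coords idx (fst q)) (coords idx (snd q)) (idx l))) has_derivative
        (\<lambda>v. \<chi> l. dE v l)) (at p)"
      by (subst has_derivative_componentwise_within) (auto simp: Basis_vec_def inner_axis)
    then have D: "(monodromy_map n idx has_derivative D) (at p)"
      unfolding monodromy_map_def D_def case_prod_unfold
      by (intro has_derivative_Pair) (auto intro!: derivative_eq_intros)
    \<comment> \<open>The terms \<open>d\<rho>\<^sub>i\<close> of \<open>dE\<^sub>i\<close> give \<open>\<Sum> dm\<^sub>i \<and> d\<rho>\<^sub>i\<close>, the terms \<open>dm\<^sub>i\<close> cancel in the wedge product, and the
        terms from \<open>X\<^sub>i\<close> and \<open>X\<^bsub>n-i\<^esub>\<close> cancel by the symmetry of the Hessian.\<close>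
    have symp: "omega_mono (D u) (D v) = omega_asym u v" for u v
    proof -
      have "(\<Sum>l\<in>UNIV. fst u $ l * (?X v (int (idx l)) - ?X v (int n - int (idx l))))
          = (\<Sum>l\<in>UNIV. fst v $ l * (?X u (int (idx l)) - ?X u (int n - int (idx l))))"
        using dlog_X_symmetric[of n "coords idx (fst u)" ?m "coords idx (fst v)"]
        by (simp add: fold_antisym_sum[OF assms(1)] idx_sum coords_idx)
      then show ?thesis
        by (simp add: omega_mono_def omega_asym_def wedge_def D_def dE_def sum_distrib_left
          sum_subtractf sum.distrib sum_negf algebra_simps)
    qed
    have "((\<lambda>(m, \<rho>). genF n (coords idx \<rho>) (coords idx m)) has_derivative
        (\<lambda>u. theta_mono (monodromy_map n idx p) (D u) - theta_asym p u)) (at p)"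
      using genF_has_derivative[where \<rho>="\<lambda>q. coords idx (snd q)" and d\<rho>="\<lambda>v. coords idx (snd v)",
          OF assms(1) dm d\<rho> gen]
      by (simp add: case_prod_unfold theta_mono_def theta_asym_def monodromy_map_def D_def
          idx_sum coords_idx)
    with D symp show "\<exists>D. (monodromy_map n idx has_derivative D) (at p) \<and>
        (\<forall>u v. omega_mono (D u) (D v) = omega_asym u v) \<and>
        ((\<lambda>(m, \<rho>). genF n (coords idx \<rho>) (coords idx m)) has_derivative
          (\<lambda>u. theta_mono (monodromy_map n idx p) (D u) - theta_asym p u)) (at p)"
      by blast
  qed
qed

end
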